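(* Let $X$ and $Z$ be Hausdorff topological vector spaces, let $C\subseteq Z$ be a convex and pointed cone with nonempty interior, and let $K$ be a nonempty, convex and closed subset of $X$. Consider mappings $f,g:K\times K\to Z$ satisfying: (i) for every $y\in K$ it holds that for every $x\in K$ and every net $(x_\alpha)\subseteq K$ with $\lim x_\alpha=x$ there exists a net $(z_\alpha)\subseteq Z$ with $\lim z_\alpha=z$ such that $f(x_\alpha,y)+g(x_\alpha,y)-z_\alpha\in-C$ and $f(x,y)+g(x,y)-z\in C$; (ii) for every $x\in K$, the mappings $y\mapsto f(x,y)$ and $y\mapsto g(x,y)$ are $C$-convex; (iii) for every $x\in K$, $f(x,x)=0$ and $g(x,x)\notin-\operatorname{int}C$; (iv) there exist a nonempty compact set $K_0\subseteq X$ and $y_0\in K$ such that $f(x,y_0)+g(x,y_0)\in-\operatorname{int}C$ for all $x\in K\setminus K_0$. Then there exists an element $x_0\in K$ such that $f(x_0,y)+g(x_0,y)\notin-\operatorname{int}C$ for all $y\in K$.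
   Context: All spaces are real. A cone $C$ satisfies $tc\in C$ for all $c\in C$, $t\ge 0$; it is convex if $C+C=C$ and pointed if $C\cap(-C)=\{0\}$ ($C$ is not assumed closed). $\operatorname{int}C$ is the interior of $C$. A map $h:K\to Z$ ($K$ convex) is $C$-convex if $th(x)+(1-t)h(y)-h(tx+(1-t)y)\in C$ for all $x,y\in K$, $t\in[0,1]$. *)

theory Defs
  imports "HOL-Analysis.Analysis" "HOL-Library.Set_Algebras"
begin

text \<open>Topological vector spaces over the reals; the Hausdorff property is the separate class
  \<open>t2_space\<close>.\<close>

class topological_real_vector = topological_ab_group_add + real_vector +
  assumes tendsto_scaleR_nhds: "((\<lambda>p. fst p *\<^sub>R snd p) \<longlongrightarrow> c *\<^sub>R x) (nhds c \<times>\<^sub>F nhds x)"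

instance real_normed_vector \<subseteq> topological_real_vector
proof
  fix c :: real and x :: 'a
  show "((\<lambda>p. fst p *\<^sub>R snd p) \<longlongrightarrow> c *\<^sub>R x) (nhds c \<times>\<^sub>F nhds x)"
    by (intro tendsto_scaleR filterlim_fst filterlim_snd)
qed

text \<open>Beware that \<open>- C\<close> is the set-theoretic complement in Isabelle/HOL; the pointwise negative
  of a set is \<open>uminus ` C\<close>.\<close>

definition pointed :: "'z::real_vector set \<Rightarrow> bool" where
  "pointed C \<longleftrightarrow> C \<inter> uminus ` C = {0}"

definition cone_convex_on :: "'z::real_vector set \<Rightarrow> 'x::real_vector set \<Rightarrow> ('x \<Rightarrow> 'z) \<Rightarrow> bool" where
  "cone_convex_on C K h \<longleftrightarrow>
     (\<forall>x\<in>K. \<forall>y\<in>K. \<forall>t\<in>{0..1}.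
        t *\<^sub>R h x + (1 - t) *\<^sub>R h y - h (t *\<^sub>R x + (1 - t) *\<^sub>R y) \<in> C)"

definition directed_set :: "'i set \<Rightarrow> ('i \<Rightarrow> 'i \<Rightarrow> bool) \<Rightarrow> bool" where
  "directed_set I le \<longleftrightarrow>
     I \<noteq> {} \<and> reflp_on I le \<and> transp_on I le \<and> (\<forall>i\<in>I. \<forall>j\<in>I. \<exists>k\<in>I. le i k \<and> le j k)"

text \<open>The filter of tails: \<open>(x \<longlongrightarrow> l) (net_filter I le)\<close> is convergence to \<open>l\<close> of the net
  \<open>x\<close> indexed by \<open>(I, le)\<close>.\<close>

definition net_filter :: "'i set \<Rightarrow> ('i \<Rightarrow> 'i \<Rightarrow> bool) \<Rightarrow> 'i filter" where
  "net_filter I le = (INF i\<in>I. principal {j\<in>I. le i j})"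

lemma eventually_net_filter:
  assumes "directed_set I le"
  shows "eventually P (net_filter I le) \<longleftrightarrow> (\<exists>i\<in>I. \<forall>j\<in>I. le i j \<longrightarrow> P j)"
  unfolding net_filter_def
proof (subst eventually_INF_base)
  show "I \<noteq> {}" using assms by (simp add: directed_set_def)
  fix a b assume ab: "a \<in> I" "b \<in> I"
  then obtain k where k: "k \<in> I" "le a k" "le b k"
    using assms unfolding directed_set_def by blast
  have "transp_on I le" using assms by (simp add: directed_set_def)
  then have "{j\<in>I. le k j} \<subseteq> {j\<in>I. le a j} \<inter> {j\<in>I. le b j}"
    using ab k unfolding transp_on_def by blast
  then show "\<exists>x\<in>I. principal {j\<in>I. le x j}
      \<le> inf (principal {j\<in>I. le a j}) (principal {j\<in>I. le b j})"
    using k by auto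
qed (auto simp: eventually_principal)

text \<open>The defining condition ranges over all nets in \<open>K\<close>. HOL cannot quantify over the type of
  the index set inside a hypothesis, so the index sets are the subsets of \<open>'x set \<times> 'x\<close>, with
  arbitrary directed preorders; the lemma below shows that this already yields the condition
  for nets indexed by directed subsets of any type.\<close>

definition net_cone_lsc_on ::
  "'z::{topological_space,ab_group_add} set \<Rightarrow> 'x::topological_space set \<Rightarrow> ('x \<Rightarrow> 'z) \<Rightarrow> bool" where
  "net_cone_lsc_on C K F \<longleftrightarrow>
     (\<forall>x\<in>K. \<forall>(I :: ('x set \<times> 'x) set) le xs.
        directed_set I le \<and> (\<forall>i\<in>I. xs i \<in> K) \<and> (xs \<longlongrightarrow> x) (net_filter I le) \<longrightarrow>
        (\<exists>zs z. (zs \<longlongrightarrow> z) (net_filter I le) \<and>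
           (\<forall>i\<in>I. F (xs i) - zs i \<in> uminus ` C) \<and> F x - z \<in> C))"

lemma net_cone_lsc_onD:
  fixes I :: "'i set" and xs :: "'i \<Rightarrow> 'x::topological_space"
    and F :: "'x \<Rightarrow> 'z::{topological_space,ab_group_add}"
  assumes lsc: "net_cone_lsc_on C K F" and x: "x \<in> K" and dir: "directed_set I le"
    and xs: "\<forall>i\<in>I. xs i \<in> K" and lim: "(xs \<longlongrightarrow> x) (net_filter I le)"
  shows "\<exists>zs z. (zs \<longlongrightarrow> z) (net_filter I le) \<and>
    (\<forall>i\<in>I. F (xs i) - zs i \<in> uminus ` C) \<and> F x - z \<in> C"
proof -
  define p where "p i = (xs ` {j\<in>I. le i j}, xs i)" for i
  define le' where "le' u v \<longleftrightarrow> fst v \<subseteq> fst u" for u v :: "'x set \<times> 'x"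
  have p_mono: "le' (p i) (p j)" if "i \<in> I" "j \<in> I" "le i j" for i j
  proof -
    have "transp_on I le" using dir by (simp add: directed_set_def)
    then have "le i k" if "k \<in> I" "le j k" for k
      using \<open>i \<in> I\<close> \<open>j \<in> I\<close> \<open>le i j\<close> that unfolding transp_on_def by blast
    then show ?thesis unfolding le'_def p_def by auto
  qed
  have dir': "directed_set (p ` I) le'"
    unfolding directed_set_def
  proof (intro conjI ballI)
    show "p ` I \<noteq> {}" using dir by (simp add: directed_set_def)
    show "reflp_on (p ` I) le'" "transp_on (p ` I) le'"
      by (auto simp: reflp_on_def transp_on_def le'_def)
    fix u v assume "u \<in> p ` I" "v \<in> p ` I"
    then obtain i j where ij: "i \<in> I" "u = p i" "j \<in> I" "v = p j" by auto
    with dir obtain k where "k \<in> I" "le i k" "le j k" unfolding directed_set_def by blast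
    then show "\<exists>w\<in>p ` I. le' u w \<and> le' v w" using ij p_mono by blast
  qed
  have "(snd \<longlongrightarrow> x) (net_filter (p ` I) le')"
    unfolding tendsto_def
  proof (intro allI impI)
    fix S assume "open S" "x \<in> S"
    with lim have "\<forall>\<^sub>F i in net_filter I le. xs i \<in> S" by (simp add: tendsto_def)
    then obtain i where i: "i \<in> I" "\<forall>j\<in>I. le i j \<longrightarrow> xs j \<in> S"
      by (auto simp: eventually_net_filter[OF dir])
    have "snd (p j) \<in> S" if "j \<in> I" "le' (p i) (p j)" for j
    proof -
      have "le j j" using dir that by (auto simp: directed_set_def reflp_on_def)
      then have "xs j \<in> fst (p j)" using that by (auto simp: p_def)
      then have "xs j \<in> fst (p i)" using that by (auto simp: le'_def)
      then show ?thesis using i by (auto simp: p_def)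
    qed
    then show "\<forall>\<^sub>F u in net_filter (p ` I) le'. snd u \<in> S"
      using i by (auto simp: eventually_net_filter[OF dir'])
  qed
  moreover have "\<forall>u\<in>p ` I. snd u \<in> K" using xs by (auto simp: p_def)
  ultimately have "\<exists>zs z. (zs \<longlongrightarrow> z) (net_filter (p ` I) le') \<and>
      (\<forall>u\<in>p ` I. F (snd u) - zs u \<in> uminus ` C) \<and> F x - z \<in> C"
    using lsc[unfolded net_cone_lsc_on_def, rule_format, OF x, of "p ` I" le' snd] dir' by simp
  then obtain zs z where z: "(zs \<longlongrightarrow> z) (net_filter (p ` I) le')"
    "\<forall>u\<in>p ` I. F (snd u) - zs u \<in> uminus ` C" "F x - z \<in> C"
    by (elim exE conjE)
  have "((\<lambda>i. zs (p i)) \<longlongrightarrow> z) (net_filter I le)"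
    unfolding tendsto_def
  proof (intro allI impI)
    fix S assume "open S" "z \<in> S"
    with z(1) have "\<forall>\<^sub>F u in net_filter (p ` I) le'. zs u \<in> S" by (simp add: tendsto_def)
    then obtain i where "i \<in> I" "\<forall>j\<in>I. le' (p i) (p j) \<longrightarrow> zs (p j) \<in> S"
      by (auto simp: eventually_net_filter[OF dir'])
    then show "\<forall>\<^sub>F i in net_filter I le. zs (p i) \<in> S"
      using p_mono by (auto simp: eventually_net_filter[OF dir])
  qed
  moreover have "\<forall>i\<in>I. F (xs i) - zs (p i) \<in> uminus ` C"
    using z(2) by (auto simp: p_def)
  ultimately show ?thesis using z(3) by (intro exI[of _ "\<lambda>i. zs (p i)"] exI[of _ z]) simp
qed

end

theory Submission
  imports Defs
begin

text \<open>
  Write \<open>F = f + g\<close> and, for \<open>y \<in> K\<close>, let \<open>G y\<close> be the set of those \<open>x \<in> K\<close> at which \<open>y\<close> brings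
  no strict decrease: \<open>- F x y \<notin> interior C\<close>. A solution is a common point of all the \<open>G y\<close>, and
  such a point is provided by the principle of Knaster, Kuratowski and Mazurkiewicz in Ky Fan's
  form (\<open>KKM_principle\<close>). Its three hypotheses correspond to the three kinds of
  assumption on \<open>F\<close>.

  The sets \<open>G y\<close> are closed by the net condition (\<open>closed_not_in_neg_interior\<close>). In the order of
  \<open>C\<close> that condition reads \<open>F x\<^sub>\<alpha> \<le> z\<^sub>\<alpha>\<close> and \<open>z \<le> F x\<close> with \<open>z\<^sub>\<alpha>\<close> tending to \<open>z\<close>. If
  \<open>F x\<close> is strictly negative, so is \<open>z\<close>; as strict negativity is an open condition, so is
  some \<open>z\<^sub>\<alpha>\<close>, and then so is \<open>F x\<^sub>\<alpha>\<close>.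

  The convex hull of a finite \<open>Y \<subseteq> K\<close> is covered by the \<open>G y\<close> with \<open>y \<in> Y\<close>. By \<open>C\<close>-convexity, for
  fixed \<open>x\<close> the points \<open>y\<close> that bring a strict decrease form a convex set
  (\<open>convex_sublevel_interior\<close>). It does not contain \<open>x\<close>, because \<open>F x x = g x x\<close> is
  not strictly negative, so it cannot contain the whole of \<open>Y\<close> when \<open>x\<close> lies in the hull of \<open>Y\<close>.

  Finally, coercivity forces \<open>G y0 \<subseteq> K0\<close>, so that \<open>G y0\<close> is compact.

  The KKM principle reduces by compactness to finitely many sets, and that case is a consequence
  of Brouwer's fixed point theorem in the dimension given by the number of sets. Since this number
  varies, Brouwer's theorem is proved here for cubes inside \<open>nat \<Rightarrow> real\<close>, where the dimension is a
  natural number instead of a type. The combinatorial core is Kuhn's labelling lemma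
  (\<open>kuhn_lemma\<close>).
\<close>

section \<open>Brouwer's theorem on cubes of arbitrary dimension\<close>

text \<open>The coordinates from \<open>n\<close> on are pinned to \<open>0\<close>, so that the cube is compact in the product
  topology and two of its points agree as soon as their first \<open>n\<close> coordinates do.\<close>

definition cube :: "nat \<Rightarrow> (nat \<Rightarrow> real) set" where
  "cube n = {x. (\<forall>i<n. 0 \<le> x i \<and> x i \<le> 1) \<and> (\<forall>i\<ge>n. x i = 0)}"

lemma tendsto_fun_iff:
  fixes X :: "'a \<Rightarrow> 'i \<Rightarrow> 'b::topological_space"
  shows "(X \<longlongrightarrow> l) F \<longleftrightarrow> (\<forall>i. ((\<lambda>k. X k i) \<longlongrightarrow> l i) F)"
  using limitin_componentwise[of "\<lambda>_. euclidean" UNIV X l F]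
  by (simp add: euclidean_product_topology)

lemma compact_cube: "compact (cube n)"
proof -
  have "cube n = PiE UNIV (\<lambda>i. if i < n then {0..1} else {0})"
    by (force simp: cube_def PiE_def Pi_def split: if_splits)
  moreover have "compactin (product_topology (\<lambda>_::nat. euclidean) UNIV)
      (PiE UNIV (\<lambda>i. if i < n then {0..1::real} else {0}))"
    by (simp add: compactin_PiE)
  ultimately show ?thesis
    by (simp add: euclidean_product_topology)
qed

text \<open>Kuhn's lemma on a grid of mesh \<open>1 / p\<close>, with a grid point labelled in direction \<open>i\<close> according
  to whether \<open>f\<close> increases or decreases its \<open>i\<close>-th coordinate. In a small cell in which both
  labels occur in every direction, \<open>f\<close> moves no coordinate consistently. Stating this with the two
  witnesses \<open>a\<close> and \<open>b\<close>, instead of a bound on \<open>f c - c\<close>, avoids uniform continuity: the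
  limit over \<open>p\<close> needs only continuity at one point.\<close>

lemma approximate_fixed_point:
  fixes f :: "(nat \<Rightarrow> real) \<Rightarrow> nat \<Rightarrow> real"
  assumes f: "f ` cube n \<subseteq> cube n" and p: "0 < p"
  shows "\<exists>c\<in>cube n. \<forall>i<n. \<exists>a\<in>cube n. \<exists>b\<in>cube n.
    (\<forall>j. \<bar>a j - c j\<bar> \<le> 1 / real p) \<and> (\<forall>j. \<bar>b j - c j\<bar> \<le> 1 / real p) \<and>
    a i \<le> f a i \<and> f b i \<le> b i"
proof -
  define e where "e x = (\<lambda>j. if j < n then real (x j) / real p else 0)" for x :: "nat \<Rightarrow> nat"
  have e_cube: "e x \<in> cube n" if "\<forall>j<n. x j \<le> p" for x
    using that p by (auto simp: e_def cube_def)
  have fe: "0 \<le> f (e x) i \<and> f (e x) i \<le> 1" if "\<forall>j<n. x j \<le> p" "i < n" for x i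
    using subsetD[OF f imageI[OF e_cube[OF that(1)]]] that(2) by (simp add: cube_def)
  \<comment> \<open>On the upper face Kuhn's lemma demands label 1, even where \<open>f\<close> fixes the coordinate.\<close>
  define label where
    "label x i = (if e x i \<le> f (e x) i \<and> x i \<noteq> p then 0 else 1 :: nat)" for x i
  have label1: "f (e x) i \<le> e x i" if "label x i \<noteq> 0" "\<forall>j<n. x j \<le> p" "i < n" for x i
    using that fe[of x i] p by (auto simp: label_def e_def split: if_splits)
  obtain q where q: "\<forall>i<n. q i < p"
    and rs: "\<forall>i<n. \<exists>r s. (\<forall>j<n. q j \<le> r j \<and> r j \<le> q j + 1) \<and>
      (\<forall>j<n. q j \<le> s j \<and> s j \<le> q j + 1) \<and> label r i \<noteq> label s i"
  proof (rule kuhn_lemma[of p n label])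
    show "\<forall>x. (\<forall>i<n. x i \<le> p) \<longrightarrow> (\<forall>i<n. x i = 0 \<longrightarrow> label x i = 0)"
      using fe p by (auto simp: label_def e_def)
  qed (use p in \<open>auto simp: label_def\<close>)
  have near: "\<bar>e r j - e q j\<bar> \<le> 1 / real p" if "\<forall>j<n. q j \<le> r j \<and> r j \<le> q j + 1" for r j
  proof (cases "j < n")
    case True
    then have "\<bar>real (r j) - real (q j)\<bar> \<le> 1" using that by force
    then have "\<bar>real (r j) - real (q j)\<bar> / real p \<le> 1 / real p"
      by (rule divide_right_mono) simp
    then show ?thesis using True by (simp add: e_def flip: diff_divide_distrib)
  qed (simp add: e_def)
  show ?thesis
  proof (rule bexI[of _ "e q"], intro allI impI)
    fix i assume i: "i < n"
    with rs obtain r s where r: "\<forall>j<n. q j \<le> r j \<and> r j \<le> q j + 1"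
      and s: "\<forall>j<n. q j \<le> s j \<and> s j \<le> q j + 1" and rs': "label r i \<noteq> label s i"
      by blast
    show "\<exists>a\<in>cube n. \<exists>b\<in>cube n.
      (\<forall>j. \<bar>a j - e q j\<bar> \<le> 1 / real p) \<and> (\<forall>j. \<bar>b j - e q j\<bar> \<le> 1 / real p) \<and>
      a i \<le> f a i \<and> f b i \<le> b i" (is ?goal)
    proof -
      have key: ?goal if uv: "label u i = 0" "label v i \<noteq> 0"
        and u: "\<forall>j<n. q j \<le> u j \<and> u j \<le> q j + 1"
        and v: "\<forall>j<n. q j \<le> v j \<and> v j \<le> q j + 1" for u v
      proof -
        have le: "w j \<le> p" if "\<forall>j<n. q j \<le> w j \<and> w j \<le> q j + 1" "j < n" for w j
          using spec[OF q, of j] spec[OF that(1), of j] that(2) by simp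
        have u': "\<forall>j<n. u j \<le> p" and v': "\<forall>j<n. v j \<le> p"
          using le[OF u] le[OF v] by simp_all
        have "e u i \<le> f (e u) i" using uv(1) by (simp add: label_def split: if_splits)
        moreover have "f (e v) i \<le> e v i" using label1[OF uv(2) v' i] .
        ultimately show ?goal
          using near[OF u] near[OF v] e_cube[OF u'] e_cube[OF v']
          by (intro bexI[of _ "e u"] bexI[of _ "e v"] conjI allI)
      qed
      have "label r i = 0 \<and> label s i \<noteq> 0 \<or> label s i = 0 \<and> label r i \<noteq> 0"
        using rs' by (auto simp: label_def split: if_splits)
      then show ?thesis using key r s by blast
    qed
  qed (use q in \<open>auto intro!: e_cube less_imp_le\<close>)
qed

text \<open>The cells of the approximate fixed points shrink to a point \<open>x\<close> along a subsequence. In each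
  coordinate the witnesses for \<open>a i \<le> f a i\<close> and for \<open>f b i \<le> b i\<close> tend to \<open>x\<close> too, so
  both inequalities hold at \<open>x\<close>.\<close>

theorem brouwer_on_cube:
  fixes f :: "(nat \<Rightarrow> real) \<Rightarrow> nat \<Rightarrow> real"
  assumes cont: "continuous_on (cube n) f" and f: "f ` cube n \<subseteq> cube n"
  shows "\<exists>x\<in>cube n. f x = x"
proof -
  have "\<forall>m. \<exists>c\<in>cube n. \<forall>i<n. \<exists>a\<in>cube n. \<exists>b\<in>cube n.
    (\<forall>j. \<bar>a j - c j\<bar> \<le> 1 / real (Suc m)) \<and> (\<forall>j. \<bar>b j - c j\<bar> \<le> 1 / real (Suc m)) \<and>
    a i \<le> f a i \<and> f b i \<le> b i"
    using approximate_fixed_point[OF f] by blast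
  then obtain c where c: "\<And>m. c m \<in> cube n"
    and ab: "\<And>m i. i < n \<Longrightarrow> \<exists>a\<in>cube n. \<exists>b\<in>cube n.
      (\<forall>j. \<bar>a j - c m j\<bar> \<le> 1 / real (Suc m)) \<and> (\<forall>j. \<bar>b j - c m j\<bar> \<le> 1 / real (Suc m)) \<and>
      a i \<le> f a i \<and> f b i \<le> b i"
    by metis
  obtain x \<phi> where x: "x \<in> cube n" and \<phi>: "strict_mono \<phi>" and lim: "(c \<circ> \<phi>) \<longlonglongrightarrow> x"
    using compact_cube[THEN compact_imp_seq_compact] c unfolding seq_compact_def by meson
  have null: "(\<lambda>m. 1 / real (Suc (\<phi> m))) \<longlonglongrightarrow> 0"
    using LIMSEQ_subseq_LIMSEQ[OF LIMSEQ_Suc[OF lim_1_over_n] \<phi>] by (simp add: o_def)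
  have close: "(\<lambda>m. u m j) \<longlonglongrightarrow> x j"
    if "\<And>m j. \<bar>u m j - c (\<phi> m) j\<bar> \<le> 1 / real (Suc (\<phi> m))" for u :: "nat \<Rightarrow> nat \<Rightarrow> real" and j
  proof -
    have "(\<lambda>m. u m j - c (\<phi> m) j) \<longlonglongrightarrow> 0"
      by (rule Lim_null_comparison[OF _ null]) (use that in auto)
    moreover have "(\<lambda>m. c (\<phi> m) j) \<longlonglongrightarrow> x j"
      using lim by (simp add: tendsto_fun_iff o_def)
    ultimately show ?thesis
      using tendsto_add by fastforce
  qed
  have lim_f: "(\<lambda>m. f (u m) j) \<longlonglongrightarrow> f x j"
    if "\<And>m. u m \<in> cube n" "\<And>m j. \<bar>u m j - c (\<phi> m) j\<bar> \<le> 1 / real (Suc (\<phi> m))" for u j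
  proof -
    have "u \<longlonglongrightarrow> x" using close[of u] that(2) by (simp add: tendsto_fun_iff)
    then have "(\<lambda>m. f (u m)) \<longlonglongrightarrow> f x"
      by (rule continuous_on_tendsto_compose[OF cont _ x]) (simp add: that(1))
    then show ?thesis by (simp add: tendsto_fun_iff)
  qed
  have "f x i = x i" for i
  proof (cases "i < n")
    case True
    have "\<forall>m. \<exists>a b. a \<in> cube n \<and> b \<in> cube n \<and>
      (\<forall>j. \<bar>a j - c (\<phi> m) j\<bar> \<le> 1 / real (Suc (\<phi> m))) \<and>
      (\<forall>j. \<bar>b j - c (\<phi> m) j\<bar> \<le> 1 / real (Suc (\<phi> m))) \<and> a i \<le> f a i \<and> f b i \<le> b i"
      using ab[OF True] by meson
    then obtain a b where a: "\<And>m. a m \<in> cube n" and b: "\<And>m. b m \<in> cube n"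
      and da: "\<And>m j. \<bar>a m j - c (\<phi> m) j\<bar> \<le> 1 / real (Suc (\<phi> m))"
      and db: "\<And>m j. \<bar>b m j - c (\<phi> m) j\<bar> \<le> 1 / real (Suc (\<phi> m))"
      and le: "\<And>m. a m i \<le> f (a m) i" "\<And>m. f (b m) i \<le> b m i"
      by metis
    show ?thesis
    proof (rule antisym)
      show "f x i \<le> x i"
        by (rule LIMSEQ_le[OF lim_f[of b] close[of b]]) (use b db le in auto)
      show "x i \<le> f x i"
        by (rule LIMSEQ_le[OF close[of a] lim_f[of a]]) (use a da le in auto)
    qed
  next
    case False
    then show ?thesis using subsetD[OF f imageI[OF x]] x by (simp add: cube_def)
  qed
  then show ?thesis using x by blast
qed

section \<open>The Knaster--Kuratowski--Mazurkiewicz principle\<close>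

lemma tendsto_scaleR_tvs:
  fixes g :: "'a \<Rightarrow> 'b::topological_real_vector"
  assumes "(f \<longlongrightarrow> a) F" "(g \<longlongrightarrow> b) F"
  shows "((\<lambda>x. f x *\<^sub>R g x) \<longlongrightarrow> a *\<^sub>R b) F"
  using filterlim_compose[OF tendsto_scaleR_nhds filterlim_Pair[OF assms]] by simp

text \<open>Suppose the sets had no common point. For a coefficient vector \<open>t\<close>, the distances \<open>d t i\<close> to
  the set of vectors whose combination of the \<open>y i\<close> lies in \<open>G i\<close> would not all vanish, and
  normalising them to sum \<open>1\<close> gives a continuous self-map of the cube. At a fixed point \<open>t\<close> the
  support of \<open>t\<close> is the set \<open>I\<close> of indices whose \<open>G i\<close> misses the combination \<open>\<sigma> t\<close>; but
  \<open>\<sigma> t\<close> lies in the hull of the \<open>y i\<close> with \<open>i \<in> I\<close>, which these \<open>G i\<close> cover. The distances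
  are taken in coefficient space because \<open>'x\<close> carries no metric.\<close>

lemma KKM_finite:
  fixes y :: "nat \<Rightarrow> 'x::topological_real_vector" and G :: "nat \<Rightarrow> 'x set"
  assumes closed: "\<And>i. i < n \<Longrightarrow> closed (G i)"
    and cover: "\<And>I. I \<subseteq> {..<n} \<Longrightarrow> convex hull (y ` I) \<subseteq> (\<Union>i\<in>I. G i)"
  shows "(\<Inter>i<n. G i) \<noteq> {}"
proof
  assume empty: "(\<Inter>i<n. G i) = {}"
  define \<sigma> where "\<sigma> t = (\<Sum>i<n. t i *\<^sub>R y i)" for t :: "nat \<Rightarrow> real"
  define A where "A i = {t. \<sigma> t \<in> G i}" for i
  define d where "d t i = infdist t (A i)" for t i
  define D where "D t = (\<Sum>i<n. d t i)" for t
  have coord: "continuous_on UNIV (\<lambda>t::nat \<Rightarrow> real. t i)" for i by simp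
  have "continuous_on UNIV \<sigma>"
    unfolding \<sigma>_def continuous_on_def
    by (intro ballI tendsto_sum tendsto_scaleR_tvs tendsto_const)
      (use coord in \<open>auto simp: continuous_on_def\<close>)
  then have A_closed: "closed (A i)" if "i < n" for i
    using closed_vimage[OF closed[OF that]] by (simp add: A_def vimage_def)
  \<comment> \<open>The distance to the empty set is \<open>0\<close> by convention, so closedness alone would not make a
    vanishing distance mean membership.\<close>
  have A_nonempty: "A i \<noteq> {}" if "i < n" for i
  proof -
    have "\<sigma> (\<lambda>j. if j = i then 1 else 0) = (\<Sum>j<n. if j = i then y j else 0)"
      unfolding \<sigma>_def by (rule sum.cong) auto
    also have "\<dots> = y i" using that by simp
    also have "\<dots> \<in> G i" using cover[of "{i}"] that by simp
    finally show ?thesis by (auto simp: A_def)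
  qed
  have d_nonneg: "0 \<le> d t i" for t i by (simp add: d_def infdist_nonneg)
  have d_0: "d t i = 0 \<longleftrightarrow> t \<in> A i" if "i < n" for t i
    using in_closed_iff_infdist_zero[OF A_closed A_nonempty] that by (simp add: d_def)
  have D_pos: "0 < D t" for t
  proof -
    obtain i where "i < n" "\<sigma> t \<notin> G i" using empty by blast
    then have "d t i \<noteq> 0" using d_0 by (simp add: A_def)
    then have "0 < d t i" using d_nonneg[of t i] by simp
    then show ?thesis
      unfolding D_def using \<open>i < n\<close> d_nonneg by (intro sum_pos2[of _ i]) auto
  qed
  define h where "h t i = (if i < n then d t i / D t else 0)" for t i
  have d_le: "d t i \<le> D t" if "i < n" for t i
    unfolding D_def using that d_nonneg by (intro member_le_sum) auto
  have "h ` cube n \<subseteq> cube n"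
    using d_nonneg D_pos d_le by (auto simp: h_def cube_def less_imp_le)
  moreover have "continuous_on (cube n) h"
  proof (rule continuous_on_coordinatewise_then_product)
    fix i
    have "continuous_on (cube n) (\<lambda>t. d t i)" for i
      unfolding d_def by (intro continuous_intros)
    moreover from this have "continuous_on (cube n) D"
      unfolding D_def by (intro continuous_intros)
    moreover have "D t \<noteq> 0" for t using D_pos[of t] by simp
    ultimately show "continuous_on (cube n) (\<lambda>t. h t i)"
      unfolding h_def by (cases "i < n") (auto intro!: continuous_intros)
  qed
  ultimately obtain t where t: "h t = t"
    using brouwer_on_cube by blast
  define I where "I = {i. i < n \<and> t \<notin> A i}"
  have t_eq: "t i = d t i / D t" if "i < n" for i
    using fun_cong[OF t, of i] that by (simp add: h_def)
  have t_0: "t i = 0" if "i \<in> {..<n} - I" for i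
    using that t_eq d_0 by (auto simp: I_def)
  have I: "I \<subseteq> {..<n}" by (auto simp: I_def)
  have "(\<Sum>i<n. t i) = (\<Sum>i<n. d t i / D t)" by (rule sum.cong) (auto simp: t_eq)
  also have "\<dots> = 1" using D_pos[of t] by (simp add: D_def flip: sum_divide_distrib)
  finally have sum1: "(\<Sum>i\<in>I. t i) = 1"
    using sum.mono_neutral_left[OF _ I, of t] t_0 by simp
  have "\<sigma> t = (\<Sum>i\<in>I. t i *\<^sub>R y i)"
    unfolding \<sigma>_def by (rule sum.mono_neutral_right[OF _ I]) (use t_0 in auto)
  also have "\<dots> \<in> convex hull (y ` I)"
  proof (rule convex_sum[OF _ convex_convex_hull sum1])
    show "finite I" using I finite_subset by blast
    fix i assume "i \<in> I"
    then have "t i = d t i / D t" using t_eq I by blast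
    then show "0 \<le> t i" using d_nonneg[of t i] D_pos[of t] by simp
    show "y i \<in> convex hull y ` I" using \<open>i \<in> I\<close> by (simp add: hull_inc)
  qed
  finally obtain i where "i \<in> I" "\<sigma> t \<in> G i" using cover[OF I] by blast
  then show False by (simp add: I_def A_def)
qed

text \<open>The compact set \<open>G y0\<close> localises the problem: it suffices that every finite subfamily,
  enlarged by \<open>G y0\<close>, has a common point.\<close>

theorem KKM_principle:
  fixes G :: "'x::topological_real_vector \<Rightarrow> 'x set"
  assumes closed: "\<And>y. y \<in> S \<Longrightarrow> closed (G y)"
    and cover: "\<And>Y. finite Y \<Longrightarrow> Y \<subseteq> S \<Longrightarrow> convex hull Y \<subseteq> (\<Union>y\<in>Y. G y)"
    and y0: "y0 \<in> S" "compact (G y0)"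
  shows "(\<Inter>y\<in>S. G y) \<noteq> {}"
proof -
  have "G y0 \<inter> (\<Inter>y\<in>S. G y) \<noteq> {}"
  proof (rule compact_imp_fip_image[OF y0(2) closed])
    fix Y assume Y: "finite Y" "Y \<subseteq> S"
    obtain n and e :: "nat \<Rightarrow> 'x" where e: "insert y0 Y = e ` {..<n}"
      using finite_imp_nat_seg_image_inj_on[of "insert y0 Y"] Y by (auto simp: lessThan_def)
    have sub: "e ` {..<n} \<subseteq> S" using e Y y0 by auto
    have "(\<Inter>i<n. G (e i)) \<noteq> {}"
    proof (rule KKM_finite[where y = e])
      fix I assume I: "I \<subseteq> {..<n}"
      then have "convex hull (e ` I) \<subseteq> (\<Union>y\<in>e ` I. G y)"
        using sub by (intro cover) (auto intro: finite_subset)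
      then show "convex hull (e ` I) \<subseteq> (\<Union>i\<in>I. G (e i))" by simp
    qed (use closed sub in auto)
    moreover have "(\<Inter>i<n. G (e i)) = (\<Inter>y\<in>insert y0 Y. G y)" by (simp add: e)
    ultimately show "G y0 \<inter> (\<Inter>y\<in>Y. G y) \<noteq> {}" by simp
  qed
  then show ?thesis by blast
qed

section \<open>Convex cones and their interiors\<close>

text \<open>Translating the interior by an element of \<open>C\<close> keeps it open and inside \<open>C\<close>, hence inside the
  interior. This is how strict inequalities are combined with weak ones.\<close>

lemma interior_cone_add:
  fixes C :: "'z::topological_real_vector set"
  assumes "C + C \<subseteq> C" "a \<in> interior C" "c \<in> C"
  shows "a + c \<in> interior C"
proof -
  have "continuous_on UNIV (\<lambda>z. z - c)"
    by (simp add: continuous_on_def tendsto_diff[OF tendsto_ident_at tendsto_const])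
  then have "open ((\<lambda>z. z - c) -` interior C)"
    by (intro open_vimage) auto
  moreover have "(\<lambda>z. z - c) -` interior C \<subseteq> C"
  proof
    fix z assume "z \<in> (\<lambda>z. z - c) -` interior C"
    then have "z - c \<in> C" using interior_subset by auto
    then have "(z - c) + c \<in> C" using assms(1,3) by (meson set_plus_intro subsetD)
    then show "z \<in> C" by simp
  qed
  ultimately have "(\<lambda>z. z - c) -` interior C \<subseteq> interior C"
    by (intro interior_maximal)
  moreover have "a + c \<in> (\<lambda>z. z - c) -` interior C" using assms(2) by simp
  ultimately show ?thesis by (rule subsetD)
qed

lemma interior_cone_scaleR:
  fixes C :: "'z::topological_real_vector set"
  assumes "cone C" "a \<in> interior C" "0 < t"
  shows "t *\<^sub>R a \<in> interior C"
proof -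
  have "continuous_on UNIV (\<lambda>z::'z. inverse t *\<^sub>R z)"
    by (simp add: continuous_on_def tendsto_scaleR_tvs[OF tendsto_const tendsto_ident_at])
  then have "open ((\<lambda>z. inverse t *\<^sub>R z) -` interior C)"
    by (intro open_vimage) auto
  moreover have "(\<lambda>z. inverse t *\<^sub>R z) -` interior C \<subseteq> C"
  proof
    fix z assume "z \<in> (\<lambda>z. inverse t *\<^sub>R z) -` interior C"
    then have "inverse t *\<^sub>R z \<in> C" using interior_subset[of C] by auto
    then have "t *\<^sub>R inverse t *\<^sub>R z \<in> C"
      using mem_cone[OF assms(1) _ less_imp_le[OF assms(3)]] by blast
    then show "z \<in> C" using assms(3) by simp
  qed
  ultimately have "(\<lambda>z. inverse t *\<^sub>R z) -` interior C \<subseteq> interior C"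
    by (intro interior_maximal)
  moreover have "t *\<^sub>R a \<in> (\<lambda>z. inverse t *\<^sub>R z) -` interior C" using assms(2,3) by simp
  ultimately show ?thesis by (rule subsetD)
qed

text \<open>A value at a convex combination is at most the combination of the values, and that
  combination is strictly negative as soon as the values are: one summand with a positive
  coefficient puts its negative into the interior, while the other one stays in \<open>C\<close>.\<close>

lemma convex_sublevel_interior:
  fixes C :: "'z::topological_real_vector set"
  assumes C: "cone C" "C + C \<subseteq> C" and K: "convex K" and h: "cone_convex_on C K h"
  shows "convex {y\<in>K. - h y \<in> interior C}"
  unfolding convex_alt
proof (intro ballI allI impI)
  fix y y' and u :: real
  assume y: "y \<in> {y\<in>K. - h y \<in> interior C}" and y': "y' \<in> {y\<in>K. - h y \<in> interior C}"
    and u: "0 \<le> u \<and> u \<le> 1"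
  let ?w = "(1 - u) *\<^sub>R y + u *\<^sub>R y'"
  have w: "?w \<in> K" using K y y' u by (simp add: convex_alt)
  have comb: "(1 - u) *\<^sub>R (- h y) + u *\<^sub>R (- h y') \<in> interior C"
  proof (cases "u = 1")
    case False
    have "- h y' \<in> C" using y' interior_subset by auto
    then show ?thesis
      using y u False C by (intro interior_cone_add interior_cone_scaleR mem_cone) auto
  qed (use y' in auto)
  have "(1 - u) *\<^sub>R h y + u *\<^sub>R h y' - h ?w \<in> C"
    using h[unfolded cone_convex_on_def, rule_format, of y y' "1 - u"] y y' u by auto
  from interior_cone_add[OF C(2) comb this] have "- h ?w \<in> interior C" by simp
  then show "?w \<in> {y\<in>K. - h y \<in> interior C}" using w by simp
qed

section \<open>Closedness of the sets without strict decrease\<close>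

text \<open>The net is indexed by pairs of a neighbourhood and a point of \<open>S\<close> in it, ordered by reverse
  inclusion of the neighbourhoods; the point of a pair is its own value, so that no choice is
  involved. This index type is the one over which \<open>net_cone_lsc_on\<close> quantifies.\<close>

lemma closure_point_net:
  fixes S :: "'x::topological_space set"
  assumes "x \<in> closure S"
  shows "\<exists>(I :: ('x set \<times> 'x) set) le. directed_set I le \<and> (\<forall>i\<in>I. snd i \<in> S) \<and>
    (snd \<longlongrightarrow> x) (net_filter I le)"
proof -
  define I where "I = {(U, u). open U \<and> x \<in> U \<and> u \<in> U \<inter> S}"
  define le :: "'x set \<times> 'x \<Rightarrow> 'x set \<times> 'x \<Rightarrow> bool" where "le i j \<longleftrightarrow> fst j \<subseteq> fst i" for i j
  have meet: "\<exists>u. (U, u) \<in> I" if "open U" "x \<in> U" for U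
    using assms that open_Int_closure_eq_empty[of U S] by (auto simp: I_def)
  have dir: "directed_set I le"
    unfolding directed_set_def
  proof (intro conjI ballI)
    show "I \<noteq> {}" using meet[of UNIV] by auto
    show "reflp_on I le" "transp_on I le" by (auto simp: reflp_on_def transp_on_def le_def)
    fix i j assume "i \<in> I" "j \<in> I"
    then have "open (fst i \<inter> fst j)" "x \<in> fst i \<inter> fst j" by (auto simp: I_def)
    then obtain u where "(fst i \<inter> fst j, u) \<in> I" using meet by blast
    then show "\<exists>k\<in>I. le i k \<and> le j k" by (rule rev_bexI) (simp add: le_def)
  qed
  moreover have "(snd \<longlongrightarrow> x) (net_filter I le)"
    unfolding tendsto_def
  proof (intro allI impI)
    fix U assume "open U" "x \<in> U"
    then obtain u where "(U, u) \<in> I" using meet by blast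
    then show "\<forall>\<^sub>F i in net_filter I le. snd i \<in> U"
      unfolding eventually_net_filter[OF dir]
      by (intro bexI[of _ "(U, u)"]) (auto simp: le_def I_def)
  qed
  ultimately show ?thesis by (intro exI[of _ I] exI[of _ le]) (auto simp: I_def)
qed

text \<open>Despite its name, \<open>net_cone_lsc_on\<close> bounds the limit value from below by the limit of upper
  bounds, which is upper semicontinuity with respect to the order of \<open>C\<close>. Hence strict negativity at
  a limit point spreads back to some member of the net.\<close>

lemma closed_not_in_neg_interior:
  fixes C :: "'z::topological_real_vector set" and K :: "'x::topological_space set"
  assumes C: "C + C \<subseteq> C" and K: "closed K" and F: "net_cone_lsc_on C K F"
  shows "closed {x\<in>K. - F x \<notin> interior C}" (is "closed ?G")
proof -
  have "x \<in> ?G" if x: "x \<in> closure ?G" for x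
  proof -
    have xK: "x \<in> K" using x closure_minimal[of ?G K] K by auto
    obtain I :: "('x set \<times> 'x) set" and le where dir: "directed_set I le"
      and I: "\<forall>i\<in>I. snd i \<in> ?G" and lim: "(snd \<longlongrightarrow> x) (net_filter I le)"
      using closure_point_net[OF x] by blast
    have IK: "\<forall>i\<in>I. snd i \<in> K" using I by simp
    obtain zs z where zs: "(zs \<longlongrightarrow> z) (net_filter I le)"
      and lower: "\<forall>i\<in>I. F (snd i) - zs i \<in> uminus ` C" and z: "F x - z \<in> C"
      using net_cone_lsc_onD[OF F xK dir IK lim] by blast
    have "- F x \<notin> interior C"
    proof
      assume "- F x \<in> interior C"
      from interior_cone_add[OF C this z] have "- z \<in> interior C" by simp
      moreover have "((\<lambda>i. - zs i) \<longlongrightarrow> - z) (net_filter I le)"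
        using zs by (rule tendsto_minus)
      ultimately have "\<forall>\<^sub>F i in net_filter I le. - zs i \<in> interior C"
        by (simp add: tendsto_def)
      then obtain i where i: "i \<in> I" "\<forall>j\<in>I. le i j \<longrightarrow> - zs j \<in> interior C"
        unfolding eventually_net_filter[OF dir] by blast
      moreover have "le i i" using dir i(1) by (simp add: directed_set_def reflp_on_def)
      ultimately have zi: "- zs i \<in> interior C" by blast
      obtain c where "c \<in> C" "F (snd i) - zs i = - c" using lower i(1) by blast
      then have "zs i - F (snd i) \<in> C" by (metis minus_diff_eq minus_minus)
      from interior_cone_add[OF C zi this] have "- F (snd i) \<in> interior C" by simp
      then show False using I i(1) by blast
    qed
    then show ?thesis using xK by simp
  qed
  then have "closure ?G \<subseteq> ?G" by (rule subsetI)
  then show ?thesis by (simp only: closure_subset_eq)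
qed

section \<open>The equilibrium theorem\<close>

lemma in_uminus_image_iff: "a \<in> uminus ` S \<longleftrightarrow> - a \<in> S" for a :: "'a::ab_group_add"
  by force

lemma cone_convex_on_add:
  assumes "C + C \<subseteq> C" "cone_convex_on C K h" "cone_convex_on C K k"
  shows "cone_convex_on C K (\<lambda>y. h y + k y)"
  unfolding cone_convex_on_def
proof (intro ballI)
  fix x y and t :: real assume xy: "x \<in> K" "y \<in> K" "t \<in> {0..1}"
  let ?w = "t *\<^sub>R x + (1 - t) *\<^sub>R y"
  have "(t *\<^sub>R h x + (1 - t) *\<^sub>R h y - h ?w) + (t *\<^sub>R k x + (1 - t) *\<^sub>R k y - k ?w) \<in> C"
    using assms xy unfolding cone_convex_on_def by (meson set_plus_intro subsetD)
  then show "t *\<^sub>R (h x + k x) + (1 - t) *\<^sub>R (h y + k y) - (h ?w + k ?w) \<in> C"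
    by (simp add: algebra_simps)
qed

theorem theorem5p1:
  fixes C :: "'z::{topological_real_vector,t2_space} set"
    and K :: "'x::{topological_real_vector,t2_space} set"
    and f g :: "'x \<Rightarrow> 'x \<Rightarrow> 'z"
  assumes C: "cone C" "C + C = C" "pointed C" "interior C \<noteq> {}"
    and K: "K \<noteq> {}" "convex K" "closed K"
    and i: "\<forall>y\<in>K. net_cone_lsc_on C K (\<lambda>x. f x y + g x y)"
    and ii: "\<forall>x\<in>K. cone_convex_on C K (\<lambda>y. f x y) \<and> cone_convex_on C K (\<lambda>y. g x y)"
    and iii: "\<forall>x\<in>K. f x x = 0 \<and> g x x \<notin> uminus ` interior C"
    and iv: "\<exists>K0 y0. K0 \<noteq> {} \<and> compact K0 \<and> y0 \<in> K \<and>
               (\<forall>x\<in>K - K0. f x y0 + g x y0 \<in> uminus ` interior C)"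
  shows "\<exists>x0\<in>K. \<forall>y\<in>K. f x0 y + g x0 y \<notin> uminus ` interior C"
proof -
  define F where "F x y = f x y + g x y" for x y
  define G where "G y = {x\<in>K. - F x y \<notin> interior C}" for y
  have C_add: "C + C \<subseteq> C" using C(2) by simp
  obtain K0 y0 where y0: "y0 \<in> K" and K0: "compact K0"
    and outside: "\<forall>x\<in>K - K0. - F x y0 \<in> interior C"
    using iv by (auto simp: F_def in_uminus_image_iff)
  have G_closed: "closed (G y)" if "y \<in> K" for y
    unfolding G_def F_def by (rule closed_not_in_neg_interior[OF C_add K(3) bspec[OF i that]])
  have "(\<Inter>y\<in>K. G y) \<noteq> {}"
  proof (rule KKM_principle[OF G_closed _ y0])
    have "G y0 = K0 \<inter> G y0" using outside by (auto simp: G_def)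
    then show "compact (G y0)" using compact_Int_closed[OF K0 G_closed[OF y0]] by simp
  next
    fix Y assume Y: "finite Y" "Y \<subseteq> K"
    show "convex hull Y \<subseteq> (\<Union>y\<in>Y. G y)"
    proof
      fix x assume x: "x \<in> convex hull Y"
      then have xK: "x \<in> K" using Y(2) K(2) hull_minimal[of Y K convex] by auto
      let ?N = "{y\<in>K. - F x y \<in> interior C}"
      have "cone_convex_on C K (F x)"
        unfolding F_def using ii xK by (intro cone_convex_on_add C_add) auto
      then have "convex ?N" by (rule convex_sublevel_interior[OF C(1) C_add K(2)])
      moreover have "x \<notin> ?N" using iii xK by (simp add: F_def in_uminus_image_iff)
      ultimately have "\<not> Y \<subseteq> ?N" using x hull_minimal[of Y ?N convex] by blast
      then show "x \<in> (\<Union>y\<in>Y. G y)" using Y(2) xK by (auto simp: G_def)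
    qed
  qed
  then obtain x0 where "\<forall>y\<in>K. x0 \<in> G y" by blast
  then show ?thesis using y0 by (auto simp: G_def F_def in_uminus_image_iff)
qed

end
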